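(* Let $n \geqslant m \geqslant 1$ be integers and let $\sigma^m = [\upsilon^0, \upsilon^1, \ldots, \upsilon^m]$ be an $m$-simplex in $\mathbb{R}^n$. Let $\kappa^m$ be the barycenter of $\sigma^m$ and let $\kappa_i^m$ be the barycenter of the $i$-th $(m-1)$-face of $\sigma^m$ (opposite to $\upsilon^i$). Then for each $i=0,1,\ldots,m$, $$\|\kappa^m-\kappa_i^m\| = \frac1{m(m+1)}\Biggl(m\sum_{\substack{j=0\\ j\neq i}}^{m} \|\upsilon^i-\upsilon^j\|^2 - \sum_{\substack{p=0\\ p\neq i}}^{m-1}\ \sum_{\substack{q=p+1\\ q\neq i}}^{m} \|\upsilon^p-\upsilon^q\|^2\Biggr)^{1/2}.$$
   Context: An $m$-simplex $[\upsilon^0,\ldots,\upsilon^m]$ in $\mathbb{R}^n$ is the convex hull of $m+1$ affinely independent points (its vertices). Its barycenter is $\kappa^m=\frac1{m+1}\sum_{j=0}^m\upsilon^j$. The $i$-th $(m-1)$-face is the convex hull of all vertices except $\upsilon^i$, and its barycenter is $\kappa_i^m = \frac1m\sum_{j\neq i}\upsilon^j$. $\|\cdot\|$ is the Euclidean norm. *)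

theory Defs
  imports "HOL-Analysis.Analysis"
begin

text \<open>
  The library predicate \<open>simplex\<close> speaks about the point set only; here the vertices are enumerated
  as \<open>v 0, \<dots>, v m\<close>, since faces are indexed by the opposite vertex. Values of \<open>v\<close> beyond \<open>m\<close>
  are irrelevant. As \<open>affine_dependent\<close> is a property of a set of points, injectivity is needed to
  express affine independence of the \<open>m + 1\<close> points of the family.
\<close>

definition simplex_with_vertices ::
    "nat \<Rightarrow> (nat \<Rightarrow> 'a::euclidean_space) \<Rightarrow> 'a set \<Rightarrow> bool" where
  "simplex_with_vertices m v S \<longleftrightarrow>
     inj_on v {0..m} \<and> \<not> affine_dependent (v ` {0..m}) \<and> S = convex hull (v ` {0..m})"

lemma simplex_with_vertices_imp_simplex:
  assumes "simplex_with_vertices m v S"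
  shows "int m simplex S"
  using assms unfolding simplex_with_vertices_def simplex_def
  by (intro exI[of _ "v ` {0..m}"]) (simp add: card_image)

definition barycenter :: "nat \<Rightarrow> (nat \<Rightarrow> 'a::euclidean_space) \<Rightarrow> 'a" where
  "barycenter m v = (1 / (real m + 1)) *\<^sub>R (\<Sum>j=0..m. v j)"

definition face_barycenter :: "nat \<Rightarrow> (nat \<Rightarrow> 'a::euclidean_space) \<Rightarrow> nat \<Rightarrow> 'a" where
  "face_barycenter m v i = (1 / real m) *\<^sub>R (\<Sum>j\<in>{0..m} - {i}. v j)"

end

theory Submission
  imports Defs
begin

text \<open>
  Up to the factor \<open>1 / (m (m + 1))\<close>, the vector between the two barycenters is the sum of the edge
  vectors issuing from \<open>v i\<close>. The squared norm of a sum of vectors is expressed through the squared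
  norms of the vectors and of their pairwise differences, and here the differences are the edges of
  the opposite face.
\<close>

text \<open>Polarization, \<open>2 * (x p \<bullet> x q)\<close> being the sum of the two squared
  norms minus the squared norm of the difference, is summed over all ordered pairs. Each
  \<open>(norm (x j))\<^sup>2\<close> then occurs \<open>2 * card A\<close> times. For infinite
  \<open>A\<close> both sides are 0.\<close>

lemma norm_sum_squared_eq_pairwise_differences:
  fixes x :: "'b \<Rightarrow> 'a::real_inner"
  shows "(norm (\<Sum>j\<in>A. x j))\<^sup>2 =
    real (card A) * (\<Sum>j\<in>A. (norm (x j))\<^sup>2) - (\<Sum>p\<in>A. \<Sum>q\<in>A. (norm (x p - x q))\<^sup>2) / 2"
proof -
  have diff: "(norm (x p - x q))\<^sup>2 = (norm (x p))\<^sup>2 + (norm (x q))\<^sup>2 - 2 * (x p \<bullet> x q)" for p q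
    by (simp add: power2_norm_eq_inner algebra_simps inner_commute)
  have "(\<Sum>p\<in>A. \<Sum>q\<in>A. (norm (x p - x q))\<^sup>2) =
      2 * (real (card A) * (\<Sum>j\<in>A. (norm (x j))\<^sup>2)) - 2 * (\<Sum>p\<in>A. \<Sum>q\<in>A. x p \<bullet> x q)"
    by (simp add: diff sum.distrib sum_subtractf sum_distrib_left)
  moreover have "(norm (\<Sum>j\<in>A. x j))\<^sup>2 = (\<Sum>p\<in>A. \<Sum>q\<in>A. x p \<bullet> x q)"
    by (simp only: power2_norm_eq_inner inner_sum_left inner_sum_right) (rule sum.swap)
  ultimately show ?thesis
    by (simp add: field_simps)
qed

text \<open>The diagonal vanishes, and exchanging the summations together with symmetry identifies
  the part below it with the part above. This turns the factor 1/2 of the previous identity into a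
  sum in which each edge counts once.\<close>

lemma sum_symmetric_eq_twice_ordered_pairs:
  fixes f :: "'b::linorder \<Rightarrow> 'b \<Rightarrow> 'a::comm_semiring_1"
  assumes "finite A" and sym: "\<And>p q. f p q = f q p" and diag: "\<And>p. f p p = 0"
  shows "(\<Sum>p\<in>A. \<Sum>q\<in>A. f p q) = 2 * (\<Sum>p\<in>A. \<Sum>q | q \<in> A \<and> p < q. f p q)"
proof -
  have "(\<Sum>q\<in>A. f p q) = (\<Sum>q | q \<in> A \<and> p < q. f p q) + (\<Sum>q | q \<in> A \<and> q < p. f p q)" for p
  proof -
    have "(\<Sum>q\<in>A. f p q) = (\<Sum>q\<in>{q \<in> A. p < q} \<union> {q \<in> A. q < p}. f p q)"
    proof (intro sum.mono_neutral_right ballI)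
      fix q assume "q \<in> A - ({q \<in> A. p < q} \<union> {q \<in> A. q < p})"
      then have "q = p"
        by auto
      then show "f p q = 0"
        by (simp add: diag)
    qed (use \<open>finite A\<close> in auto)
    also have "\<dots> = (\<Sum>q | q \<in> A \<and> p < q. f p q) + (\<Sum>q | q \<in> A \<and> q < p. f p q)"
      using \<open>finite A\<close> by (intro sum.union_disjoint) auto
    finally show ?thesis .
  qed
  moreover have "(\<Sum>p\<in>A. \<Sum>q | q \<in> A \<and> q < p. f p q) = (\<Sum>p\<in>A. \<Sum>q | q \<in> A \<and> p < q. f p q)"
    using sum.swap_restrict[OF \<open>finite A\<close> \<open>finite A\<close>, of f "\<lambda>p q. q < p"] by (simp add: sym)
  ultimately show ?thesis
    by (simp add: sum.distrib mult_2)
qed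

text \<open>With \<open>s\<close> the sum of the vertices of the face, the barycenters are
  \<open>(v i + s) / (m + 1)\<close> and \<open>s / m\<close>, while the edge vectors add up to
  \<open>m * v i - s\<close>; it remains to compare the coefficients of \<open>v i\<close> and
  \<open>s\<close>.\<close>

lemma barycenter_minus_face_barycenter:
  assumes "1 \<le> m" and "i \<in> {0..m}"
  shows "barycenter m v - face_barycenter m v i =
    (1 / (real m * (real m + 1))) *\<^sub>R (\<Sum>j\<in>{0..m} - {i}. v i - v j)"
proof -
  define s where "s = (\<Sum>j\<in>{0..m} - {i}. v j)"
  have total: "(\<Sum>j=0..m. v j) = v i + s"
    using assms unfolding s_def by (intro sum.remove) auto
  have "(\<Sum>j\<in>{0..m} - {i}. v i - v j) = real m *\<^sub>R v i - s"
    using assms by (simp add: sum_subtractf s_def sum_constant_scaleR)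
  \<comment> \<open>The coefficients of \<open>s\<close> and of \<open>v i\<close>. Both identities
    fail for \<open>m = 0\<close>, where division by zero gives 0.\<close>
  moreover have "1 / (real m + 1) - 1 / real m = - (1 / (real m * (real m + 1)))"
    and "1 / (real m * (real m + 1)) * real m = 1 / (real m + 1)"
    using assms by (simp_all add: divide_simps)
  ultimately have "(1 / (real m * (real m + 1))) *\<^sub>R (\<Sum>j\<in>{0..m} - {i}. v i - v j) =
      (1 / (real m + 1)) *\<^sub>R v i + (1 / (real m + 1) - 1 / real m) *\<^sub>R s"
    by (simp only: scaleR_right_diff_distrib scaleR_scaleR scaleR_minus_left) simp
  with total show ?thesis
    by (simp add: barycenter_def face_barycenter_def s_def[symmetric] scaleR_diff_left
        scaleR_right_distrib)
qed

theorem lemma3p25: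
  fixes m :: nat and v :: "nat \<Rightarrow> real ^ 'n" and S :: "(real ^ 'n) set"
  assumes "1 \<le> m" and "m \<le> CARD('n)"
    and "simplex_with_vertices m v S"
  shows "\<forall>i\<in>{0..m}.
    norm (barycenter m v - face_barycenter m v i) =
      1 / (real m * (real m + 1)) *
      sqrt (real m * (\<Sum>j\<in>{0..m} - {i}. (norm (v i - v j))\<^sup>2)
            - (\<Sum>p\<in>{0..m - 1} - {i}. \<Sum>q\<in>{p + 1..m} - {i}. (norm (v p - v q))\<^sup>2))"
proof
  fix i assume i: "i \<in> {0..m}"
  let ?A = "{0..m} - {i}"
  let ?d = "\<lambda>p q. (norm (v p - v q))\<^sup>2"
  \<comment> \<open>The common endpoint \<open>v i\<close> cancels, leaving an edge of the opposite
    face.\<close>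
  have edge: "(norm ((v i - v p) - (v i - v q)))\<^sup>2 = ?d p q" for p q
    by (simp add: norm_minus_commute)
  have "(\<Sum>p\<in>?A. \<Sum>q\<in>?A. ?d p q) / 2 = (\<Sum>p\<in>?A. \<Sum>q | q \<in> ?A \<and> p < q. ?d p q)"
    by (subst sum_symmetric_eq_twice_ordered_pairs) (simp_all add: norm_minus_commute)
  also have "\<dots> = (\<Sum>p\<in>?A. \<Sum>q\<in>{p + 1..m} - {i}. ?d p q)"
    by (intro sum.cong) auto
  also have "\<dots> = (\<Sum>p\<in>{0..m - 1} - {i}. \<Sum>q\<in>{p + 1..m} - {i}. ?d p q)"
  proof (intro sum.mono_neutral_right ballI)
    fix p assume "p \<in> ?A - ({0..m - 1} - {i})"
    then have "{p + 1..m} - {i} = {}"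
      by auto
    then show "(\<Sum>q\<in>{p + 1..m} - {i}. ?d p q) = 0"
      by (simp only: sum.empty)
  qed auto
  finally have pairs: "(\<Sum>p\<in>?A. \<Sum>q\<in>?A. ?d p q) / 2 =
    (\<Sum>p\<in>{0..m - 1} - {i}. \<Sum>q\<in>{p + 1..m} - {i}. ?d p q)" .
  have "(norm (\<Sum>j\<in>?A. v i - v j))\<^sup>2 = real m * (\<Sum>j\<in>?A. ?d i j)
      - (\<Sum>p\<in>{0..m - 1} - {i}. \<Sum>q\<in>{p + 1..m} - {i}. ?d p q)"
    \<comment> \<open>The face has \<open>m\<close> vertices, so \<open>card ?A\<close> supplies the
      factor \<open>m\<close>.\<close>
    using i unfolding norm_sum_squared_eq_pairwise_differences edge pairs by simp
  then have "norm (\<Sum>j\<in>?A. v i - v j) = sqrt (real m * (\<Sum>j\<in>?A. ?d i j)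
      - (\<Sum>p\<in>{0..m - 1} - {i}. \<Sum>q\<in>{p + 1..m} - {i}. ?d p q))"
    \<comment> \<open>The radicand is the square of a norm, so its nonnegativity needs no separate
      argument.\<close>
    by (intro real_sqrt_unique[symmetric]) simp_all
  then show "norm (barycenter m v - face_barycenter m v i) =
      1 / (real m * (real m + 1)) * sqrt (real m * (\<Sum>j\<in>?A. ?d i j)
        - (\<Sum>p\<in>{0..m - 1} - {i}. \<Sum>q\<in>{p + 1..m} - {i}. ?d p q))"
    unfolding barycenter_minus_face_barycenter[OF \<open>1 \<le> m\<close> i] norm_scaleR by simp
qed

end
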